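(* Let $\mathbb{D}$ be the open unit disc and let $f=h\overline g:\mathbb{D}\to\mathbb{C}$ be a non-vanishing logharmonic sense-preserving mapping with dilatation $\omega$. If for all $z\in\mathbb{D}$ $$\left|zP_f(z)\right|+(1+|\omega(z)|)\left|z\frac{h'}{h}(z)\right|+\frac{|z\omega'(z)|}{1-|\omega(z)|^2}\leq\frac{1}{1-|z|^2},$$ then $f$ is univalent (injective) in $\mathbb{D}$. The constant $1$ is sharp: for every $C>1$ the statement fails if the right-hand side is replaced by $\dfrac{C}{1-|z|^2}$.
   Context: A non-vanishing sense-preserving (locally univalent) logharmonic mapping $f=h\overline{g}$ on a domain: $h,g$ are non-vanishing analytic functions there, $h'$ does not vanish, and the (second complex) dilatation $\omega=\dfrac{g'h}{gh'}$ satisfies $|\omega|<1$ everywhere. Its pre-Schwarzian derivative is $$P_f=\frac{h''}{h'}+\omega\frac{h'}{h}-\frac{\omega'\overline{\omega}}{1-|\omega|^2}.$$ *)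

theory Defs
  imports "HOL-Complex_Analysis.Complex_Analysis"
begin

definition dilatation :: "(complex \<Rightarrow> complex) \<Rightarrow> (complex \<Rightarrow> complex) \<Rightarrow> complex \<Rightarrow> complex" where
  "dilatation h g z = (deriv g z * h z) / (g z * deriv h z)"

(* The factors h and g are explicit arguments. They are determined by f = h * cnj g only up to
   (h, g) |-> (c * h, g / cnj c) with c a nonzero constant, and neither the dilatation nor the
   pre-Schwarzian below changes under this replacement. *)
definition sense_preserving_logharmonic_on ::
    "complex set \<Rightarrow> (complex \<Rightarrow> complex) \<Rightarrow> (complex \<Rightarrow> complex) \<Rightarrow> (complex \<Rightarrow> complex) \<Rightarrow> bool" where
  "sense_preserving_logharmonic_on D f h g \<longleftrightarrow>
     open D \<and> connected D \<and> D \<noteq> {} \<and>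
     h holomorphic_on D \<and> g holomorphic_on D \<and>
     (\<forall>z\<in>D. f z = h z * cnj (g z)) \<and>
     (\<forall>z\<in>D. h z \<noteq> 0 \<and> g z \<noteq> 0 \<and> deriv h z \<noteq> 0 \<and> cmod (dilatation h g z) < 1)"

definition pre_Schwarzian :: "(complex \<Rightarrow> complex) \<Rightarrow> (complex \<Rightarrow> complex) \<Rightarrow> complex \<Rightarrow> complex" where
  "pre_Schwarzian h g z =
     deriv (deriv h) z / deriv h z
     + dilatation h g z * (deriv h z / h z)
     - deriv (dilatation h g) z * cnj (dilatation h g z)
         / of_real (1 - (cmod (dilatation h g z))\<^sup>2)"

end

theory Submission
  imports Defs
begin

text \<open>Univalence reduces to Becker's criterion: \<open>\<bar>z F''/F'\<bar> \<le> 1 / (1 - \<bar>z\<bar>\<^sup>2)\<close> implies that an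
  analytic \<open>F\<close> is injective, since its Ahlfors--Becker extension to the plane is a proper local
  homeomorphism of the plane. It is applied to \<open>h g\<^sup>\<mu>\<close> for unimodular \<open>\<mu>\<close>. Sharpness comes
  from the case \<open>\<omega> = 0\<close> and a perturbation of the inverse of \<open>v + exp v\<close>.\<close>

text \<open>Write p = h'/h. For F = h g^mu, the quotient F''/F' equals P_f + (mu - 1) omega p +
  omega' X with X = mu/(1 + mu omega) + cnj omega/(1 - |omega|^2), and |X| = 1/(1 - |omega|^2) for
  every unimodular mu. Since |mu - 1| |omega| <= 2 |omega| < 1 + |omega|, the three terms of the
  hypothesis give Becker's bound for all mu at once, so mu may be fitted to the two points under
  comparison. The extension reflects in the unit circle, so it needs f beyond the closed disc, and
  its Jacobian is positive only under a strict inequality; passing to f(r z) with r < 1 provides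
  both. To conclude that a proper local homeomorphism is injective, one value with exactly one
  preimage must be known. For the extension it is found far out, where the map is nearly linear; for
  v + exp v it is the value 1.\<close>

section \<open>Global injectivity of proper, locally injective maps\<close>

lemma clopen_sequential_eq:
  fixes B N :: "'a::metric_space set"
  assumes "connected B" "open N" "N \<subseteq> B" "N \<noteq> {}"
    and seq: "\<And>w l. (\<And>n. w n \<in> N) \<Longrightarrow> w \<longlonglongrightarrow> l \<Longrightarrow> l \<in> B \<Longrightarrow> l \<in> N"
  shows "N = B"
proof -
  have "closedin (top_of_set B) N"
    unfolding closedin_limpt
  proof (intro conjI allI impI)
    fix l assume "l islimpt N \<and> l \<in> B"
    then obtain w where "\<And>n. w n \<in> N - {l}" "w \<longlonglongrightarrow> l"
      unfolding islimpt_sequential by blast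
    then show "l \<in> N" using seq[of w l] \<open>l islimpt N \<and> l \<in> B\<close> by auto
  qed fact
  moreover have "openin (top_of_set B) N"
    using assms by (simp add: openin_open_eq open_subset)
  ultimately show ?thesis
    using assms unfolding connected_clopen by blast
qed

text \<open>The points with at least two preimages form a clopen subset of the target, as do the points
  with at least one.\<close>

lemma proper_locally_injective_imp_bij_betw:
  fixes F :: "'a::euclidean_space \<Rightarrow> 'a"
  assumes cont: "continuous_on A F" and B: "connected B" and AB: "F ` A \<subseteq> B"
    and loc: "\<And>z. z \<in> A \<Longrightarrow> \<exists>r>0. ball z r \<subseteq> A \<and> inj_on F (ball z r)"
    and proper: "\<And>x l. (\<And>n. x n \<in> A) \<Longrightarrow> (\<lambda>n. F (x n)) \<longlonglongrightarrow> l \<Longrightarrow> l \<in> B \<Longrightarrow>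
                   \<exists>a\<in>A. \<exists>r. strict_mono r \<and> (\<lambda>n. x (r n)) \<longlonglongrightarrow> a"
    and uniq: "w0 \<in> B" "\<exists>!z. z \<in> A \<and> F z = w0"
  shows "bij_betw F A B"
proof -
  have lim: "(\<lambda>n. F (x n)) \<longlonglongrightarrow> F a" if "\<And>n. x n \<in> A" "x \<longlonglongrightarrow> a" "a \<in> A" for x a
    using continuous_on_tendsto_compose[OF cont that(2,3)] that(1) by simp
  \<comment> \<open>Local injectivity yields open images by invariance of domain, which is why
    source and target share one Euclidean type.\<close>
  have nhd: "\<exists>U. z \<in> U \<and> U \<subseteq> ball z e \<and> U \<subseteq> A \<and> open (F ` U)" if "z \<in> A" "e > 0" for z e
  proof -
    obtain r where r: "r > 0" "ball z r \<subseteq> A" "inj_on F (ball z r)" using loc \<open>z \<in> A\<close> by blast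
    have "open (F ` ball z (min r e))"
      using r by (intro invariance_of_domain continuous_on_subset[OF cont] inj_on_subset[OF r(3)]) auto
    then show ?thesis using r that by (intro exI[of _ "ball z (min r e)"]) auto
  qed
  define N where "N = {w. \<exists>a\<in>A. \<exists>b\<in>A. a \<noteq> b \<and> F a = w \<and> F b = w}"
  have "open N"
  proof (rule openI)
    fix w assume "w \<in> N"
    then obtain a b where ab: "a \<in> A" "b \<in> A" "a \<noteq> b" "F a = w" "F b = w" by (auto simp: N_def)
    define e where "e = dist a b / 2"
    have "e > 0" using ab by (simp add: e_def)
    obtain U where U: "a \<in> U" "U \<subseteq> ball a e" "U \<subseteq> A" "open (F ` U)"
      using nhd[OF ab(1) \<open>e > 0\<close>] by blast
    obtain V where V: "b \<in> V" "V \<subseteq> ball b e" "V \<subseteq> A" "open (F ` V)"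
      using nhd[OF ab(2) \<open>e > 0\<close>] by blast
    have disj: "U \<inter> V = {}"
    proof -
      have "ball a e \<inter> ball b e = {}" unfolding e_def by (intro disjoint_ballI) auto
      then show ?thesis using U V by blast
    qed
    have "F ` U \<inter> F ` V \<subseteq> N"
    proof
      fix y assume "y \<in> F ` U \<inter> F ` V"
      then obtain u v where uv: "u \<in> U" "v \<in> V" "y = F u" "y = F v" by (elim IntE imageE)
      have "u \<in> A" "v \<in> A" using uv(1,2) U(3) V(3) by auto
      moreover have "u \<noteq> v" using uv(1,2) disj by auto
      ultimately show "y \<in> N"
        unfolding N_def mem_Collect_eq using uv(3,4) by (metis (no_types))
    qed
    moreover have "open (F ` U \<inter> F ` V)" "w \<in> F ` U \<inter> F ` V"
      using U(4) V(4) U(1) V(1) ab(4,5) by (blast, metis IntI imageI)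
    ultimately show "\<exists>e>0. ball w e \<subseteq> N"
      by (meson open_contains_ball subset_trans)
  qed
  have "N \<subseteq> B" using AB by (auto simp: N_def)
  \<comment> \<open>Properness, applied twice along nested subsequences, gives limits
    \<open>a\<close> and \<open>b\<close> of the two preimages. They cannot merge: near a common
    limit \<open>F\<close> would identify distinct points in every ball.\<close>
  have Nseq: "l \<in> N" if w: "\<And>n. w n \<in> N" "w \<longlonglongrightarrow> l" "l \<in> B" for w l
  proof -
    have "\<forall>n. \<exists>a b. a \<in> A \<and> b \<in> A \<and> a \<noteq> b \<and> F a = w n \<and> F b = w n"
      using w(1) unfolding N_def by blast
    then obtain x y where xy: "\<And>n. x n \<in> A" "\<And>n. y n \<in> A" "\<And>n. x n \<noteq> y n"
      "\<And>n. F (x n) = w n" "\<And>n. F (y n) = w n" by metis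
    obtain a r where a: "a \<in> A" "strict_mono r" "(\<lambda>n. x (r n)) \<longlonglongrightarrow> a"
      using proper[of x l] xy w by auto
    have wr: "(\<lambda>n. w (r n)) \<longlonglongrightarrow> l" using LIMSEQ_subseq_LIMSEQ[OF w(2) a(2)] by (simp add: o_def)
    obtain b q where b: "b \<in> A" "strict_mono q" "(\<lambda>n. y (r (q n))) \<longlonglongrightarrow> b"
      using proper[of "\<lambda>n. y (r n)" l] xy wr w(3) by auto
    have wrq: "(\<lambda>n. w (r (q n))) \<longlonglongrightarrow> l"
      using LIMSEQ_subseq_LIMSEQ[OF wr b(2)] by (simp add: o_def)
    have xa: "(\<lambda>n. x (r (q n))) \<longlonglongrightarrow> a"
      using LIMSEQ_subseq_LIMSEQ[OF a(3) b(2)] by (simp add: o_def)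
    have Fa: "F a = l" using lim[OF _ xa a(1)] xy wrq LIMSEQ_unique by auto
    have Fb: "F b = l" using lim[OF _ b(3) b(1)] xy wrq LIMSEQ_unique by auto
    have "a \<noteq> b"
    proof
      assume "a = b"
      obtain s where s: "s > 0" "inj_on F (ball a s)" using loc a(1) by blast
      have "eventually (\<lambda>n. x (r (q n)) \<in> ball a s \<and> y (r (q n)) \<in> ball a s) sequentially"
        using topological_tendstoD[OF xa, of "ball a s"] topological_tendstoD[OF b(3), of "ball a s"]
          s \<open>a = b\<close> by (auto intro: eventually_conj)
      then obtain n where "x (r (q n)) \<in> ball a s" "y (r (q n)) \<in> ball a s"
        by (auto simp: eventually_sequentially)
      then show False using s(2) xy by (metis inj_onD)
    qed
    then show ?thesis using a b Fa Fb unfolding N_def by blast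
  qed
  \<comment> \<open>The value with a single preimage excludes \<open>N = B\<close>, the only
    alternative to \<open>N = {}\<close>.\<close>
  have "w0 \<notin> N" using uniq(2) by (auto simp: N_def)
  have "N = {}"
  proof (rule ccontr)
    assume "N \<noteq> {}"
    have "N = B"
    proof (rule clopen_sequential_eq[OF B \<open>open N\<close> \<open>N \<subseteq> B\<close> \<open>N \<noteq> {}\<close>])
      fix w l assume "\<And>n. w n \<in> N" "w \<longlonglongrightarrow> l" "l \<in> B"
      then show "l \<in> N" by (rule Nseq)
    qed
    then show False using \<open>w0 \<notin> N\<close> uniq(1) by simp
  qed
  then have "inj_on F A" unfolding N_def inj_on_def by blast
  moreover have "F ` A = B"
  proof (rule clopen_sequential_eq[OF B _ AB])
    show "open (F ` A)"
    proof (rule openI)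
      fix w assume "w \<in> F ` A"
      then obtain z where "z \<in> A" "w = F z" by blast
      with nhd[of z 1] obtain U where "z \<in> U" "U \<subseteq> A" "open (F ` U)" by auto
      then show "\<exists>e>0. ball w e \<subseteq> F ` A"
        using \<open>w = F z\<close> by (meson image_eqI image_mono open_contains_ball subset_trans)
    qed
    show "F ` A \<noteq> {}" using uniq(2) by blast
    fix w l assume w: "\<And>n. w n \<in> F ` A" "w \<longlonglongrightarrow> l" "l \<in> B"
    have "\<exists>x. x \<in> A \<and> F x = w n" for n using w(1)[of n] by (elim imageE) auto
    then obtain x where x: "\<And>n. x n \<in> A" "\<And>n. F (x n) = w n" by metis
    obtain a r where a: "a \<in> A" "strict_mono r" "(\<lambda>n. x (r n)) \<longlonglongrightarrow> a"
      using proper[of x l] x w by auto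
    have "(\<lambda>n. w (r n)) \<longlonglongrightarrow> l" using LIMSEQ_subseq_LIMSEQ[OF w(2) a(2)] by (simp add: o_def)
    then have "F a = l" using lim[OF _ a(3,1)] x LIMSEQ_unique by auto
    then show "l \<in> F ` A" using a by blast
  qed
  ultimately show ?thesis by (simp add: bij_betw_def)
qed

section \<open>Quantitative and local injectivity from the two Wirtinger derivatives\<close>

text \<open>The real-linear map \<open>A0 * v + B0 * cnj v\<close> stretches lengths by at least
  \<open>cmod A0 - cmod B0\<close>, while by the mean value inequality the remainder
  \<open>G\<close> is \<open>e\<close>-Lipschitz on the convex set. A large disc far from 0 is
  treated with the same lemma as a small ball.\<close>

lemma nearly_affine_imp_inj_on:
  fixes F A B :: "complex \<Rightarrow> complex" and A0 B0 :: complex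
  assumes "convex S"
    and der: "\<And>z. z \<in> S \<Longrightarrow> (F has_derivative (\<lambda>v. A z * v + B z * cnj v)) (at z)"
    and near: "\<And>z. z \<in> S \<Longrightarrow> cmod (A z - A0) + cmod (B z - B0) \<le> e"
    and e: "e < cmod A0 - cmod B0"
  shows "inj_on F S"
proof (rule inj_onI)
  fix a b assume ab: "a \<in> S" "b \<in> S" "F a = F b"
  define G where "G z = F z - (A0 * z + B0 * cnj z)" for z
  have "(G has_derivative (\<lambda>v. (A z - A0) * v + (B z - B0) * cnj v)) (at z within S)" if "z \<in> S" for z
  proof -
    have "(G has_derivative (\<lambda>v. (A z * v + B z * cnj v) - (A0 * v + B0 * cnj v))) (at z within S)"
      unfolding G_def
      by (rule has_derivative_diff[OF has_derivative_at_withinI[OF der[OF that]]])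
         (auto intro!: derivative_eq_intros)
    moreover have "(\<lambda>v. (A z * v + B z * cnj v) - (A0 * v + B0 * cnj v)) =
      (\<lambda>v. (A z - A0) * v + (B z - B0) * cnj v)" by (simp add: algebra_simps)
    ultimately show ?thesis by simp
  qed
  moreover have "onorm (\<lambda>v. (A z - A0) * v + (B z - B0) * cnj v) \<le> e" if "z \<in> S" for z
  proof (rule onorm_le)
    fix v
    have "cmod ((A z - A0) * v + (B z - B0) * cnj v) \<le> (cmod (A z - A0) + cmod (B z - B0)) * cmod v"
      by (rule order_trans[OF norm_triangle_ineq]) (simp add: norm_mult distrib_right)
    also have "\<dots> \<le> e * cmod v" using near[OF that] by (intro mult_right_mono) auto
    finally show "norm ((A z - A0) * v + (B z - B0) * cnj v) \<le> e * norm v" .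
  qed
  ultimately have "norm (G a - G b) \<le> e * norm (a - b)"
    using ab by (intro differentiable_bound[OF \<open>convex S\<close>, of G "\<lambda>z v. (A z - A0) * v + (B z - B0) * cnj v"])
  moreover have "G a - G b = - (A0 * (a - b) + B0 * cnj (a - b))"
    using ab by (simp add: G_def algebra_simps)
  then have "norm (G a - G b) = cmod (A0 * (a - b) + B0 * cnj (a - b))" by (simp only: norm_minus_cancel)
  moreover have "cmod (A0 * (a - b) + B0 * cnj (a - b)) \<ge> (cmod A0 - cmod B0) * cmod (a - b)"
    using norm_diff_ineq[of "A0 * (a - b)" "B0 * cnj (a - b)"]
    by (simp add: norm_mult left_diff_distrib complex_mod_cnj del: complex_cnj_diff)
  ultimately have "(cmod A0 - cmod B0 - e) * cmod (a - b) \<le> 0" by (simp add: algebra_simps)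
  then show "a = b" using e by (simp add: mult_le_0_iff)
qed

text \<open>The Jacobian at \<open>z0\<close> is |A|^2 - |B|^2 > 0. By continuity the derivatives
  stay within half of the gap |A| - |B| on a small ball.\<close>

lemma C1_locally_injective:
  fixes F A B :: "complex \<Rightarrow> complex"
  assumes "open S" "z0 \<in> S"
    and der: "\<And>z. z \<in> S \<Longrightarrow> (F has_derivative (\<lambda>v. A z * v + B z * cnj v)) (at z)"
    and cont: "isCont A z0" "isCont B z0"
    and jac: "cmod (B z0) < cmod (A z0)"
  shows "\<exists>r>0. ball z0 r \<subseteq> S \<and> inj_on F (ball z0 r)"
proof -
  define e where "e = (cmod (A z0) - cmod (B z0)) / 2"
  have "((\<lambda>z. cmod (A z - A z0) + cmod (B z - B z0)) \<longlongrightarrow> cmod (A z0 - A z0) + cmod (B z0 - B z0)) (at z0)"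
    using cont unfolding isCont_def by (intro tendsto_intros)
  then have "eventually (\<lambda>z. cmod (A z - A z0) + cmod (B z - B z0) < e) (at z0)"
    by (rule order_tendstoD) (use jac in \<open>simp add: e_def\<close>)
  then obtain d where d: "d > 0"
    "\<And>z. z \<noteq> z0 \<Longrightarrow> dist z z0 < d \<Longrightarrow> cmod (A z - A z0) + cmod (B z - B z0) < e"
    unfolding eventually_at by blast
  obtain r where r: "r > 0" "ball z0 r \<subseteq> S" using assms open_contains_ball by blast
  have "inj_on F (ball z0 (min d r))"
  proof (rule nearly_affine_imp_inj_on[where e=e and ?A0.0 = "A z0" and ?B0.0 = "B z0"])
    fix z assume z: "z \<in> ball z0 (min d r)"
    then show "(F has_derivative (\<lambda>v. A z * v + B z * cnj v)) (at z)" using r by (intro der) auto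
    show "cmod (A z - A z0) + cmod (B z - B z0) \<le> e"
      using d(2)[of z] z jac by (cases "z = z0") (auto simp: dist_commute e_def less_imp_le)
  qed (use jac in \<open>auto simp: e_def field_simps\<close>)
  then show ?thesis using d r by (intro exI[of _ "min d r"]) auto
qed

section \<open>The Ahlfors-Becker extension and Becker's criterion under a strict inequality\<close>

text \<open>Identity on the closed disc and reflection 1/cnj z outside; the \<open>max\<close> puts
  both into one formula that is visibly continuous.\<close>

definition disc_retract :: "complex \<Rightarrow> complex" where
  "disc_retract z = z / of_real ((max 1 (cmod z))\<^sup>2)"

lemma disc_retract_inside: "cmod z \<le> 1 \<Longrightarrow> disc_retract z = z"
  by (simp add: disc_retract_def)

lemma disc_retract_outside: "cmod z \<ge> 1 \<Longrightarrow> disc_retract z = inverse (cnj z)"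
  by (auto simp: disc_retract_def max_def field_simps complex_norm_square simp del: of_real_power)

lemma isCont_disc_retract: "isCont disc_retract z"
proof -
  have "max 1 (cmod z) \<noteq> 0" by (auto simp: max_def)
  then show ?thesis unfolding disc_retract_def
    by (intro continuous_intros) auto
qed

lemma norm_disc_retract: "cmod (disc_retract z) = cmod z / (max 1 (cmod z))\<^sup>2"
  by (simp add: disc_retract_def norm_divide norm_power max_def)

lemma norm_disc_retract_le_1: "cmod (disc_retract z) \<le> 1"
  using mult_left_mono[of 1 "cmod z" "cmod z"]
  by (auto simp: norm_disc_retract max_def divide_simps power2_eq_square)

lemma norm_disc_retract_mult_le_1: "cmod (disc_retract z) * cmod z \<le> 1"
  by (auto simp: norm_disc_retract max_def divide_simps power2_eq_square mult_le_one)

lemma disc_retract_scale: "z = of_real ((max 1 (cmod z))\<^sup>2) * disc_retract z"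
proof -
  have "max 1 (cmod z) \<noteq> 0" by (auto simp: max_def)
  then show ?thesis by (simp add: disc_retract_def)
qed

text \<open>The Ahlfors--Becker extension of \<open>f\<close> to the plane; \<open>becker_ext_bar\<close> is its derivative with
  respect to the conjugate variable.\<close>

definition becker_ext :: "(complex \<Rightarrow> complex) \<Rightarrow> complex \<Rightarrow> complex" where
  "becker_ext f z = f (disc_retract z) + (z - disc_retract z) * deriv f (disc_retract z)"

definition becker_ext_bar :: "(complex \<Rightarrow> complex) \<Rightarrow> complex \<Rightarrow> complex" where
  "becker_ext_bar f z =
     - (disc_retract z)\<^sup>2 * (z - disc_retract z) * deriv (deriv f) (disc_retract z)"

context
  fixes f :: "complex \<Rightarrow> complex" and R :: real
  assumes R: "R > 1" and holf: "f holomorphic_on ball 0 R"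
begin

text \<open>Outside the disc the reflection is antiholomorphic. Differentiating f(m) + (z - m)
  f'(m), the two terms carrying f'(m) and the derivative of m cancel. What remains is f'(m) in the
  direction z and a multiple of f''(m) in the direction cnj z.\<close>

lemma has_derivative_becker_ext:
  "(becker_ext f has_derivative
     (\<lambda>v. deriv f (disc_retract z) * v + becker_ext_bar f z * cnj v)) (at z)"
proof -
  let ?m = "\<lambda>z. inverse (cnj z)"
  define E where "E z = f (?m z) + (z - ?m z) * deriv f (?m z)" for z
  define E' where "E' z v = deriv f (?m z) * v - (?m z)\<^sup>2 * (z - ?m z) * deriv (deriv f) (?m z) * cnj v" for z v
  have holf': "deriv f holomorphic_on ball 0 R" using holf by (intro holomorphic_deriv) auto
  have derf: "(f has_derivative (*) (deriv f w)) (at w)"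
       "(deriv f has_derivative (*) (deriv (deriv f) w)) (at w)" if "cmod w \<le> 1" for w
    using that R holomorphic_derivI[OF holf, of w] holomorphic_derivI[OF holf', of w]
    by (auto simp: has_field_derivative_def)
  have derE: "(E has_derivative E' z) (at z)" if z: "cmod z \<ge> 1" for z
  proof -
    have z0: "cnj z \<noteq> 0" using z by auto
    have m: "cmod (?m z) \<le> 1" using z by (simp add: norm_divide norm_inverse divide_simps)
    have dm: "(?m has_derivative (\<lambda>v. - (?m z * cnj v * ?m z))) (at z)"
      using has_derivative_compose[OF has_derivative_cnj[OF has_derivative_ident] has_derivative_inverse'[OF z0]]
      by simp
    note d1 = has_derivative_compose[OF dm derf(1)[OF m]]
    note d2 = has_derivative_compose[OF dm derf(2)[OF m]]
    have "(E has_derivative (\<lambda>v. deriv f (?m z) * - (?m z * cnj v * ?m z) +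
        ((z - ?m z) * (deriv (deriv f) (?m z) * - (?m z * cnj v * ?m z)) +
         (v - - (?m z * cnj v * ?m z)) * deriv f (?m z)))) (at z)"
      unfolding E_def
      by (intro has_derivative_add d1 has_derivative_mult d2 has_derivative_diff dm has_derivative_ident)
    moreover have "(\<lambda>v. deriv f (?m z) * - (?m z * cnj v * ?m z) +
        ((z - ?m z) * (deriv (deriv f) (?m z) * - (?m z * cnj v * ?m z)) +
         (v - - (?m z * cnj v * ?m z)) * deriv f (?m z))) = E' z"
      unfolding E'_def fun_eq_iff by (simp add: algebra_simps power2_eq_square)
    ultimately show ?thesis by simp
  qed
  have unit: "?m x = x" if "cmod x = 1" for x
    using disc_retract_outside[of x] disc_retract_inside[of x] that by simp
  have cl: "closure (- cball (0::complex) 1) = - ball 0 1"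
    by (simp add: closure_complement)
  let ?S = "cball (0::complex) 1" and ?T = "- cball (0::complex) 1"
  have in_S: "cmod z \<le> 1" if "z \<in> ?S \<union> (closure ?S \<inter> closure ?T)" using that by auto
  have in_T: "1 \<le> cmod z" if "z \<in> ?T \<union> (closure ?S \<inter> closure ?T)" using that by (auto simp: cl)
  have bdry: "?m z = z" if "z \<in> closure ?S" "z \<in> closure ?T" using that by (intro unit) (auto simp: cl)
  \<comment> \<open>The closures of the two pieces meet in the circle. There
    \<open>?m z = z\<close>, so the factor \<open>z - ?m z\<close> vanishes and both values and
    derivatives agree.\<close>
  have "((\<lambda>x. if x \<in> ?S then f x else E x) has_derivative
          (if z \<in> ?S then (*) (deriv f z) else E' z)) (at z within (?S \<union> ?T))"
  proof (rule has_derivative_If_within_closures[where x = z and S = ?S and T = ?T and f = f and g = E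
          and f' = "\<lambda>x. (*) (deriv f x)" and g' = E'], goal_cases)
    case 1 then show ?case using has_derivative_at_withinI[OF derf(1)[OF in_S]] by blast
  next
    case 2 then show ?case using has_derivative_at_withinI[OF derE[OF in_T]] by blast
  next
    case 3 then show ?case using bdry by (simp add: E_def)
  next
    case 4 then show ?case using bdry by (simp add: E'_def fun_eq_iff)
  next
    case 5 then show ?case by simp
  qed
  moreover have "(\<lambda>x. if x \<in> cball 0 1 then f x else E x) = becker_ext f"
    by (auto simp: fun_eq_iff becker_ext_def E_def disc_retract_inside disc_retract_outside)
  moreover have "(if z \<in> cball 0 1 then (*) (deriv f z) else E' z) =
      (\<lambda>v. deriv f (disc_retract z) * v + becker_ext_bar f z * cnj v)"
    by (auto simp: fun_eq_iff becker_ext_bar_def E'_def disc_retract_inside disc_retract_outside)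
  ultimately show ?thesis by simp
qed

lemma isCont_becker_ext_derivs:
  "isCont (\<lambda>z. deriv f (disc_retract z)) z" "isCont (becker_ext_bar f) z"
proof -
  have hol: "deriv f holomorphic_on ball 0 R" "deriv (deriv f) holomorphic_on ball 0 R"
    using holf by (auto intro!: holomorphic_deriv)
  have "disc_retract z \<in> ball 0 R" using norm_disc_retract_le_1[of z] R by simp
  then have "isCont (deriv f) (disc_retract z)" "isCont (deriv (deriv f)) (disc_retract z)"
    using hol[THEN holomorphic_on_imp_continuous_on] by (auto simp: continuous_on_eq_continuous_at)
  then have c: "isCont (\<lambda>z. deriv f (disc_retract z)) z" "isCont (\<lambda>z. deriv (deriv f) (disc_retract z)) z"
    using isCont_o2[OF isCont_disc_retract] by auto
  then show "isCont (\<lambda>z. deriv f (disc_retract z)) z" by simp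
  show "isCont (becker_ext_bar f) z"
    unfolding becker_ext_bar_def by (intro continuous_intros c isCont_disc_retract)
qed

text \<open>Outside the disc |rho|^2 |z - rho| = (1 - |rho|^2) |rho| for the reflected point rho;
  inside, the left side is 0. Hence Becker's inequality at rho says precisely that the
  cnj-derivative is dominated by the z-derivative f'(rho).\<close>

lemma norm_becker_ext_bar:
  "cmod (becker_ext_bar f z) \<le>
     (1 - (cmod (disc_retract z))\<^sup>2) * cmod (disc_retract z * deriv (deriv f) (disc_retract z))"
proof -
  define \<rho> where "\<rho> = disc_retract z"
  define k where "k = (max 1 (cmod z))\<^sup>2"
  have k: "k \<ge> 1" by (simp add: k_def)
  have "z - \<rho> = of_real (k - 1) * \<rho>"
    using disc_retract_scale[of z] by (simp add: \<rho>_def k_def algebra_simps)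
  then have n: "cmod (z - \<rho>) = (k - 1) * cmod \<rho>" using k by (simp add: norm_mult del: of_real_diff)
  have "(cmod \<rho>)\<^sup>2 * (k - 1) \<le> 1 - (cmod \<rho>)\<^sup>2"
  proof -
    have "cmod z \<le> max 1 (cmod z)" by simp
    then have "(cmod z)\<^sup>2 \<le> k" unfolding k_def by (intro power_mono) auto
    moreover have "cmod \<rho> = cmod z / k" by (simp add: \<rho>_def k_def norm_disc_retract)
    moreover have "(cmod z / k)\<^sup>2 * k = (cmod z)\<^sup>2 / k" using k by (simp add: power2_eq_square)
    ultimately have "(cmod \<rho>)\<^sup>2 * k \<le> 1" using k by simp
    then show ?thesis by (simp add: algebra_simps)
  qed
  then have "((cmod \<rho>)\<^sup>2 * (k - 1)) * cmod (\<rho> * deriv (deriv f) \<rho>)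
      \<le> (1 - (cmod \<rho>)\<^sup>2) * cmod (\<rho> * deriv (deriv f) \<rho>)"
    by (intro mult_right_mono) auto
  moreover have "cmod (becker_ext_bar f z) = (cmod \<rho>)\<^sup>2 * (k - 1) * cmod (\<rho> * deriv (deriv f) \<rho>)"
    by (simp add: becker_ext_bar_def norm_mult norm_power n flip: \<rho>_def)
  ultimately show ?thesis by (simp add: \<rho>_def)
qed

text \<open>Since |rho| |z| <= 1, f'(rho) differs from f'(0) by O(1/|z|). The first bound gives
  properness of the extension, the second its injectivity on discs far from 0.\<close>

lemma bounded_becker_ext_diff:
  "\<exists>K>0. \<forall>z. cmod (becker_ext f z - deriv f 0 * z) \<le> K \<and>
     cmod z * (cmod (deriv f (disc_retract z) - deriv f 0) + cmod (becker_ext_bar f z)) \<le> K"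
proof -
  have hol: "deriv f holomorphic_on ball 0 R" "deriv (deriv f) holomorphic_on ball 0 R"
    using holf by (auto intro!: holomorphic_deriv)
  have sub: "cball 0 1 \<subseteq> ball (0::complex) R" using R by auto
  have "compact (g ` cball 0 1)" if "g holomorphic_on ball 0 R" for g :: "complex \<Rightarrow> complex"
    using holomorphic_on_imp_continuous_on[OF that] sub
    by (intro compact_continuous_image) (auto intro: continuous_on_subset)
  then have bdd: "\<exists>B>0. \<forall>w. cmod w \<le> 1 \<longrightarrow> cmod (g w) \<le> B" if "g holomorphic_on ball 0 R" for g
    using that compact_imp_bounded[of "g ` cball 0 1"] unfolding bounded_pos by force
  obtain B0 where B0: "B0 > 0" "\<And>w. cmod w \<le> 1 \<Longrightarrow> cmod (f w) \<le> B0" using bdd[OF holf] by blast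
  obtain B1 where B1: "B1 > 0" "\<And>w. cmod w \<le> 1 \<Longrightarrow> cmod (deriv f w) \<le> B1" using bdd[OF hol(1)] by blast
  obtain B2 where B2: "B2 > 0" "\<And>w. cmod w \<le> 1 \<Longrightarrow> cmod (deriv (deriv f) w) \<le> B2"
    using bdd[OF hol(2)] by blast
  have lip: "cmod (deriv f w - deriv f 0) \<le> B2 * cmod w" if "cmod w \<le> 1" for w
  proof -
    have "cmod (deriv f w - deriv f 0) \<le> B2 * cmod (w - 0)"
    proof (rule field_differentiable_bound[of "cball 0 1"])
      show "(deriv f has_field_derivative deriv (deriv f) z) (at z within cball 0 1)" if "z \<in> cball 0 1" for z
        using holomorphic_derivI[OF hol(1)] sub that by blast
    qed (use that B2 in auto)
    then show ?thesis by simp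
  qed
  have "cmod (becker_ext f z - deriv f 0 * z) \<le> B0 + B1 + B2 + B2 \<and>
     cmod z * (cmod (deriv f (disc_retract z) - deriv f 0) + cmod (becker_ext_bar f z)) \<le> B0 + B1 + B2 + B2" for z
  proof -
    define \<rho> where "\<rho> = disc_retract z"
    have \<rho>: "cmod \<rho> \<le> 1" "cmod \<rho> * cmod z \<le> 1"
      by (simp_all add: \<rho>_def norm_disc_retract_le_1 norm_disc_retract_mult_le_1)
    have 1: "cmod z * cmod (deriv f \<rho> - deriv f 0) \<le> B2"
    proof -
      have "cmod z * cmod (deriv f \<rho> - deriv f 0) \<le> cmod z * (B2 * cmod \<rho>)"
        using lip[OF \<rho>(1)] by (intro mult_left_mono) auto
      also have "\<dots> = B2 * (cmod \<rho> * cmod z)" by simp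
      also have "\<dots> \<le> B2 * 1" using \<rho> B2 by (intro mult_left_mono) auto
      finally show ?thesis by simp
    qed
    have 2: "cmod z * cmod (becker_ext_bar f z) \<le> B2"
    proof -
      have "cmod (becker_ext_bar f z) \<le> (1 - (cmod \<rho>)\<^sup>2) * (cmod \<rho> * cmod (deriv (deriv f) \<rho>))"
        using norm_becker_ext_bar[of z] by (simp add: \<rho>_def norm_mult)
      also have "\<dots> \<le> 1 * (cmod \<rho> * B2)"
        using B2(2)[OF \<rho>(1)] \<rho>(1) by (intro mult_mono) (auto simp: power_le_one)
      finally have "cmod z * cmod (becker_ext_bar f z) \<le> cmod z * (cmod \<rho> * B2)"
        by (intro mult_left_mono) auto
      also have "\<dots> = (cmod \<rho> * cmod z) * B2" by simp
      also have "\<dots> \<le> 1 * B2" using \<rho> B2 by (intro mult_right_mono) auto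
      finally show ?thesis by simp
    qed
    have "becker_ext f z - deriv f 0 * z = f \<rho> - \<rho> * deriv f \<rho> + z * (deriv f \<rho> - deriv f 0)"
      by (simp add: becker_ext_def \<rho>_def algebra_simps)
    also have "cmod \<dots> \<le> cmod (f \<rho>) + cmod (\<rho> * deriv f \<rho>) + cmod (z * (deriv f \<rho> - deriv f 0))"
      by (rule order_trans[OF norm_triangle_ineq]) (intro add_right_mono norm_triangle_ineq4)
    also have "\<dots> \<le> B0 + 1 * B1 + B2"
      unfolding norm_mult using B0(2)[OF \<rho>(1)] B1 B1(2)[OF \<rho>(1)] \<rho>(1) 1
      by (intro add_mono mult_mono) auto
    finally show ?thesis using 1 2 B0(1) B1(1) B2(1) by (simp add: \<rho>_def distrib_left)
  qed
  then show ?thesis using B0(1) B1(1) B2(1) by (intro exI[of _ "B0 + B1 + B2 + B2"]) auto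
qed

lemma becker_univalence_strict:
  assumes strict: "\<And>z. cmod z \<le> 1 \<Longrightarrow>
    (1 - (cmod z)\<^sup>2) * cmod (z * deriv (deriv f) z) < cmod (deriv f z)"
  shows "inj_on f (cball 0 1)"
proof -
  let ?F = "becker_ext f"
  define a where "a = cmod (deriv f 0)"
  have a: "a > 0" using strict[of 0] by (simp add: a_def)
  obtain K where K: "K > 0" "\<And>z. cmod (?F z - deriv f 0 * z) \<le> K"
    "\<And>z. cmod z * (cmod (deriv f (disc_retract z) - deriv f 0) + cmod (becker_ext_bar f z)) \<le> K"
    using bounded_becker_ext_diff by blast
  note der = has_derivative_becker_ext
  have "bij_betw ?F UNIV UNIV"
  proof (rule proper_locally_injective_imp_bij_betw)
    show "continuous_on UNIV ?F"
      using der by (intro has_derivative_continuous_on) (auto intro: has_derivative_at_withinI)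
    show "\<exists>r>0. ball z r \<subseteq> UNIV \<and> inj_on ?F (ball z r)" for z
    proof (rule C1_locally_injective[OF _ _ der isCont_becker_ext_derivs])
      show "cmod (becker_ext_bar f z) < cmod (deriv f (disc_retract z))"
        using norm_becker_ext_bar[of z] strict[OF norm_disc_retract_le_1[of z]] by linarith
    qed auto
  next
    fix x :: "nat \<Rightarrow> complex" and l assume "(\<lambda>n. ?F (x n)) \<longlonglongrightarrow> l"
    then have "bounded (range (\<lambda>n. ?F (x n)))" by (rule convergent_imp_bounded)
    then obtain Q where Q: "\<And>n. cmod (?F (x n)) \<le> Q" unfolding bounded_iff by auto
    have "cmod (x n) \<le> (Q + K) / a" for n
    proof -
      have "cmod (deriv f 0 * x n) \<le> cmod (?F (x n)) + cmod (?F (x n) - deriv f 0 * x n)"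
        by (metis norm_minus_commute norm_triangle_sub)
      then have "cmod (x n) * a \<le> Q + K" using Q[of n] K(2)[of "x n"] by (simp add: norm_mult a_def mult.commute)
      then show ?thesis using a by (simp add: field_simps)
    qed
    then have "bounded (range x)" unfolding bounded_iff by auto
    then show "\<exists>a\<in>UNIV. \<exists>r. strict_mono r \<and> (\<lambda>n. x (r n)) \<longlonglongrightarrow> a"
      using bounded_imp_convergent_subsequence[of x] by (auto simp: o_def)
  next
    \<comment> \<open>Any z with the same value as \<open>N\<close> lies within 2 K / a of it, that
      is in \<open>S\<close>, because the extension is within K of f'(0) z. The choice of
      \<open>N\<close> keeps \<open>S\<close> in the region |z| > 2 K / a, where the derivative
      deviates from f'(0) by at most a / 2, so the extension is injective on
      \<open>S\<close>.\<close>
    define N where "N = 2 * K / a + 2 * K / a + 1"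
    define S :: "complex set" where "S = cball (of_real N) (2 * K / a)"
    have inj: "inj_on ?F S"
    proof (rule nearly_affine_imp_inj_on[OF _ der, where e = "a/2" and ?A0.0 = "deriv f 0" and ?B0.0 = 0])
      fix z assume "z \<in> S"
      then have "dist (of_real N) z \<le> 2 * K / a" by (simp add: S_def)
      moreover have "cmod (of_real N) \<le> dist (of_real N) z + cmod z"
        by (metis dist_norm norm_triangle_sub add.commute)
      moreover have "0 < 2 * K / a" using K(1) a by simp
      then have "2 * K / a + 2 * K / a < N" "cmod (of_real N) = N" unfolding N_def norm_of_real by linarith+
      ultimately have z: "2 * K / a < cmod z" by linarith
      have pos: "cmod z > 0" using z \<open>0 < 2 * K / a\<close> by linarith
      then have "K / cmod z \<le> a / 2" using z a by (simp add: divide_simps mult_ac)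
      moreover have "cmod (deriv f (disc_retract z) - deriv f 0) + cmod (becker_ext_bar f z) \<le> K / cmod z"
        using K(3)[of z] pos by (simp add: field_simps)
      ultimately show "cmod (deriv f (disc_retract z) - deriv f 0) + cmod (becker_ext_bar f z - 0) \<le> a / 2"
        unfolding diff_zero by linarith
    qed (use a in \<open>auto simp: S_def a_def\<close>)
    show "\<exists>!z. z \<in> UNIV \<and> ?F z = ?F (of_real N)"
    proof (rule ex1I)
      fix z assume "z \<in> UNIV \<and> ?F z = ?F (of_real N)"
      then have eq: "?F z = ?F (of_real N)" by simp
      have "deriv f 0 * (of_real N - z) = (?F z - deriv f 0 * z) - (?F (of_real N) - deriv f 0 * of_real N)"
        using eq by (simp add: algebra_simps)
      then have "cmod (deriv f 0 * (of_real N - z)) \<le> K + K"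
        using K(2)[of z] K(2)[of "of_real N"] norm_triangle_ineq4 by (smt (verit))
      then have "a * dist (of_real N) z \<le> 2 * K" by (simp add: norm_mult a_def dist_norm)
      then have "z \<in> S" using a by (simp add: S_def field_simps)
      moreover have "of_real N \<in> S" using K(1) a by (simp add: S_def)
      ultimately show "z = of_real N" using inj eq by (meson inj_onD)
    qed simp
  qed auto
  then have "inj_on ?F (cball 0 1)" by (auto simp: bij_betw_def inj_on_def)
  moreover have "?F z = f z" if "z \<in> cball 0 1" for z
    using that by (simp add: becker_ext_def disc_retract_inside)
  ultimately show ?thesis by (simp add: inj_on_def)
qed

end

section \<open>Becker's criterion on the open disc\<close>

text \<open>Apply the strict version to f(r z), with r < 1 exceeding the moduli of both points. For
  w = r z the weight 1 - |z|^2 is smaller than 1 - |w|^2 unless z = 0, which makes the inequality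
  strict; where w f''(w) = 0, strictness comes from f'(w) being nonzero.\<close>

theorem becker_univalence:
  assumes holf: "f holomorphic_on ball 0 1"
    and nz: "\<And>z. z \<in> ball 0 1 \<Longrightarrow> deriv f z \<noteq> 0"
    and le: "\<And>z. z \<in> ball 0 1 \<Longrightarrow>
      (1 - (cmod z)\<^sup>2) * cmod (z * deriv (deriv f) z) \<le> cmod (deriv f z)"
  shows "inj_on f (ball 0 1)"
proof (rule inj_onI)
  fix z1 z2 assume z: "z1 \<in> ball 0 1" "z2 \<in> ball 0 1" "f z1 = f z2"
  obtain r where r: "max (cmod z1) (cmod z2) < r" "r < 1"
    using dense[of "max (cmod z1) (cmod z2)" 1] z by auto
  then have r0: "0 < r" by (meson le_less_trans max.cobounded1 norm_ge_zero)
  define g where "g z = f (of_real r * z)" for z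
  have holf': "deriv f holomorphic_on ball 0 1" using holf by (intro holomorphic_deriv) auto
  have in1: "of_real r * z \<in> ball 0 1" if "z \<in> ball 0 (1/r)" for z :: complex
    using that r0 by (simp add: norm_mult field_simps)
  have chain: "((\<lambda>z. F (of_real r * z)) has_field_derivative of_real r * F') (at z)"
    if "(F has_field_derivative F') (at (of_real r * z))" for F F' z
  proof -
    have "((\<lambda>z. of_real r * z) has_field_derivative of_real r) (at z)"
      by (auto intro!: derivative_eq_intros)
    from DERIV_chain2[OF that this] show ?thesis by (simp only: mult.commute)
  qed
  have dg: "(g has_field_derivative of_real r * deriv f (of_real r * z)) (at z)" if "z \<in> ball 0 (1/r)" for z
    unfolding g_def
    using chain[OF holomorphic_derivI[OF holf open_ball in1[OF that]]] .
  have dg1: "deriv g z = of_real r * deriv f (of_real r * z)" if "z \<in> ball 0 (1/r)" for z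
    using dg[OF that] by (rule DERIV_imp_deriv)
  have dg2: "deriv (deriv g) z = (of_real r)\<^sup>2 * deriv (deriv f) (of_real r * z)" if "z \<in> ball 0 (1/r)" for z
  proof -
    have "((\<lambda>z. of_real r * deriv f (of_real r * z)) has_field_derivative
        of_real r * (of_real r * deriv (deriv f) (of_real r * z))) (at z)"
      by (intro DERIV_cmult chain holomorphic_derivI[OF holf' open_ball in1[OF that]])
    then have "(deriv g has_field_derivative of_real r * (of_real r * deriv (deriv f) (of_real r * z))) (at z)"
      by (rule has_field_derivative_transform_within_open[OF _ open_ball that]) (simp add: dg1)
    then show ?thesis by (simp add: DERIV_imp_deriv power2_eq_square)
  qed
  have "inj_on g (cball 0 1)"
  proof (rule becker_univalence_strict[of "1/r"])
    show "1 < 1 / r" using r r0 by simp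
    show "g holomorphic_on ball 0 (1/r)"
      using dg holomorphic_on_open by blast
    fix z :: complex assume z: "cmod z \<le> 1"
    define w where "w = of_real r * z"
    have "r * cmod z \<le> r" using mult_left_le[OF z] r0 by simp
    then have "r * cmod z < 1" using r by simp
    then have zb: "z \<in> ball 0 (1/r)" using r0 by (simp add: field_simps)
    have w: "w \<in> ball 0 1" using in1[OF zb] by (simp add: w_def)
    define X where "X = cmod (w * deriv (deriv f) w)"
    have "(1 - (cmod z)\<^sup>2) * X < cmod (deriv f w)"
    proof (cases "X = 0")
      case True
      then show ?thesis using nz[OF w] by simp
    next
      case False
      then have "z \<noteq> 0" "X > 0" by (auto simp: X_def w_def)
      have "(cmod w)\<^sup>2 = r\<^sup>2 * (cmod z)\<^sup>2" using r0 by (simp add: w_def norm_mult power_mult_distrib)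
      also have "\<dots> < 1 * (cmod z)\<^sup>2"
        using r r0 \<open>z \<noteq> 0\<close> by (intro mult_strict_right_mono) (auto simp: power_less_one_iff)
      finally have "(1 - (cmod z)\<^sup>2) * X < (1 - (cmod w)\<^sup>2) * X" using \<open>X > 0\<close> by simp
      then show ?thesis using le[OF w] by (simp add: X_def)
    qed
    then have "r * ((1 - (cmod z)\<^sup>2) * X) < r * cmod (deriv f w)" using r0 by simp
    then show "(1 - (cmod z)\<^sup>2) * cmod (z * deriv (deriv g) z) < cmod (deriv g z)"
      using r0 by (simp add: dg1[OF zb] dg2[OF zb] X_def w_def norm_mult power2_eq_square mult_ac)
  qed
  moreover have "z1 / of_real r \<in> cball 0 1" "z2 / of_real r \<in> cball 0 1"
    using r r0 by (auto simp: norm_divide)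
  moreover have "g (z1 / of_real r) = g (z2 / of_real r)" using r0 z by (simp add: g_def)
  ultimately have "z1 / of_real r = z2 / of_real r" by (meson inj_onD)
  then show "z1 = z2" using r0 by simp
qed

section \<open>Univalence of logharmonic mappings\<close>

text \<open>The sum is (mu + cnj omega) / ((1 + mu omega)(1 - |omega|^2)), and mu + cnj omega = mu
  cnj (1 + mu omega) has the modulus of the first factor below. This is the coefficient of omega'
  when P_f is compared with the pre-Schwarzian of h g^mu.\<close>

lemma norm_unimodular_dilatation_shift:
  fixes \<mu> \<omega> :: complex
  assumes \<mu>: "cmod \<mu> = 1" and \<omega>: "cmod \<omega> < 1"
  shows "cmod (\<mu> / (1 + \<mu> * \<omega>) + cnj \<omega> / of_real (1 - (cmod \<omega>)\<^sup>2)) = 1 / (1 - (cmod \<omega>)\<^sup>2)"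
proof -
  have nz: "1 + \<mu> * \<omega> \<noteq> 0"
  proof
    assume "1 + \<mu> * \<omega> = 0"
    then have "\<mu> * \<omega> = - 1" by (simp add: add_eq_0_iff)
    then have "cmod (\<mu> * \<omega>) = 1" by simp
    then show False using assms by (simp add: norm_mult)
  qed
  have d: "1 - (cmod \<omega>)\<^sup>2 > 0" using \<omega> by (simp add: power_less_one_iff)
  have sq: "of_real (1 - (cmod \<omega>)\<^sup>2) = 1 - \<omega> * cnj \<omega>" by (simp add: complex_norm_square del: of_real_power)
  have dz: "1 - \<omega> * cnj \<omega> \<noteq> 0" using d sq by (metis of_real_eq_0_iff less_irrefl)
  have "\<mu> / (1 + \<mu> * \<omega>) + cnj \<omega> / (1 - \<omega> * cnj \<omega>) = (\<mu> + cnj \<omega>) / ((1 + \<mu> * \<omega>) * (1 - \<omega> * cnj \<omega>))"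
    using nz dz by (simp add: divide_simps) (simp add: algebra_simps)
  moreover have "cmod (\<mu> + cnj \<omega>) = cmod (1 + \<mu> * \<omega>)"
  proof -
    have "\<mu> * cnj \<mu> = 1" using \<mu> by (metis complex_norm_square of_real_1 one_power2)
    then have "\<mu> + cnj \<omega> = \<mu> * cnj (1 + \<mu> * \<omega>)" by (simp add: distrib_left flip: mult.assoc)
    then show ?thesis using \<mu> by (metis norm_mult complex_mod_cnj mult_1)
  qed
  moreover have "cmod (1 - \<omega> * cnj \<omega>) = 1 - (cmod \<omega>)\<^sup>2"
    unfolding sq[symmetric] norm_of_real using d by simp
  ultimately show ?thesis using nz unfolding sq by (simp add: norm_divide norm_mult)
qed

text \<open>Writing \<open>h = exp H\<close> and \<open>g = exp G\<close>, each analytic function \<open>exp (H + \<mu> G)\<close> with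
  \<open>\<bar>\<mu>\<bar> = 1\<close> satisfies Becker's criterion. A coincidence \<open>f z1 = f z2\<close> makes
  \<open>(H z1 - H z2) + cnj (G z1 - G z2)\<close> a multiple of \<open>2 \<pi> i\<close>, and choosing \<open>\<mu>\<close> so that
  \<open>\<mu> (G z1 - G z2) = cnj (G z1 - G z2)\<close> turns it into one for \<open>exp (H + \<mu> G)\<close>.\<close>

lemma logharmonic_becker_univalence:
  assumes sp: "sense_preserving_logharmonic_on (ball 0 1) f h g"
    and bound: "\<And>z. z \<in> ball 0 1 \<Longrightarrow>
               cmod (z * pre_Schwarzian h g z)
               + (1 + cmod (dilatation h g z)) * cmod (z * (deriv h z / h z))
               + cmod (z * deriv (dilatation h g) z) / (1 - (cmod (dilatation h g z))\<^sup>2)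
               \<le> 1 / (1 - (cmod z)\<^sup>2)"
  shows "inj_on f (ball 0 1)"
proof (rule inj_onI)
  fix z1 z2 assume z12: "z1 \<in> ball 0 1" "z2 \<in> ball 0 1" "f z1 = f z2"
  let ?D = "ball (0::complex) 1"
  let ?\<omega> = "dilatation h g"
  have holh: "h holomorphic_on ?D" and holg: "g holomorphic_on ?D"
    and nz: "\<And>z. z \<in> ?D \<Longrightarrow> h z \<noteq> 0" "\<And>z. z \<in> ?D \<Longrightarrow> g z \<noteq> 0" "\<And>z. z \<in> ?D \<Longrightarrow> deriv h z \<noteq> 0"
    and \<omega>1: "\<And>z. z \<in> ?D \<Longrightarrow> cmod (?\<omega> z) < 1"
    and feq: "\<And>z. z \<in> ?D \<Longrightarrow> f z = h z * cnj (g z)"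
    using sp unfolding sense_preserving_logharmonic_on_def by auto
  have contr: "contractible ?D" by (simp add: convex_imp_contractible)
  obtain H where H: "H holomorphic_on ?D" "\<And>z. z \<in> ?D \<Longrightarrow> h z = exp (H z)"
    using contractible_imp_holomorphic_log[OF holh contr nz(1)] by metis
  obtain G where G: "G holomorphic_on ?D" "\<And>z. z \<in> ?D \<Longrightarrow> g z = exp (G z)"
    using contractible_imp_holomorphic_log[OF holg contr nz(2)] by metis
  have holh': "deriv h holomorphic_on ?D" using holh by (intro holomorphic_deriv) auto
  have hol\<omega>: "?\<omega> holomorphic_on ?D"
  proof -
    have "?\<omega> = (\<lambda>z. (deriv g z * h z) / (g z * deriv h z))"
      by (simp add: fun_eq_iff dilatation_def)
    moreover have "(\<lambda>z. (deriv g z * h z) / (g z * deriv h z)) holomorphic_on ?D"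
      using nz by (intro holomorphic_intros holh holg holh') auto
    ultimately show ?thesis by simp
  qed
  define a where "a = H z1 - H z2"
  define b where "b = G z1 - G z2"
  have "exp (H z1 + cnj (G z1)) = exp (H z2 + cnj (G z2))"
    using z12 H G feq by (simp add: exp_add exp_cnj)
  then obtain n :: int where n: "H z1 + cnj (G z1) = H z2 + cnj (G z2) + of_int (2 * n) * of_real pi * \<i>"
    unfolding exp_eq by auto
  define \<mu> where "\<mu> = (if b = 0 then 1 else cnj b / b)"
  have \<mu>: "cmod \<mu> = 1" "\<mu> * b = cnj b" by (auto simp: \<mu>_def norm_divide)
  define \<phi> where "\<phi> z = exp (H z + \<mu> * G z)" for z
  have "a + \<mu> * b = a + cnj b" by (simp add: \<mu>(2))
  also have "\<dots> = of_int (2 * n) * of_real pi * \<i>"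
    using n by (simp add: a_def b_def algebra_simps)
  finally have "a + \<mu> * b = of_int (2 * n) * of_real pi * \<i>" .
  then have "H z1 + \<mu> * G z1 = H z2 + \<mu> * G z2 + of_int (2 * n) * of_real pi * \<i>"
    by (simp add: a_def b_def algebra_simps)
  then have eq: "\<phi> z1 = \<phi> z2" unfolding \<phi>_def exp_eq by (intro exI[of _ n]) simp
  have dH: "deriv H z = deriv h z / h z" if z: "z \<in> ?D" for z
  proof -
    have "((\<lambda>z. exp (H z)) has_field_derivative exp (H z) * deriv H z) (at z)"
      by (intro DERIV_fun_exp holomorphic_derivI[OF H(1)] z) auto
    then have "(h has_field_derivative exp (H z) * deriv H z) (at z)"
      by (rule has_field_derivative_transform_within_open[OF _ open_ball z]) (simp add: H)
    then have "deriv h z = h z * deriv H z" using H(2)[OF z] by (simp add: DERIV_imp_deriv)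
    then show ?thesis using nz(1)[OF z] by simp
  qed
  have dG: "deriv G z = ?\<omega> z * (deriv h z / h z)" if z: "z \<in> ?D" for z
  proof -
    have "((\<lambda>z. exp (G z)) has_field_derivative exp (G z) * deriv G z) (at z)"
      by (intro DERIV_fun_exp holomorphic_derivI[OF G(1)] z) auto
    then have "(g has_field_derivative exp (G z) * deriv G z) (at z)"
      by (rule has_field_derivative_transform_within_open[OF _ open_ball z]) (simp add: G)
    then have "deriv g z = g z * deriv G z" using G(2)[OF z] by (simp add: DERIV_imp_deriv)
    then show ?thesis using nz[OF z] by (simp add: dilatation_def)
  qed
  define p where "p z = deriv h z / h z" for z
  have d\<phi>: "(\<phi> has_field_derivative \<phi> z * (p z * (1 + \<mu> * ?\<omega> z))) (at z)" if z: "z \<in> ?D" for z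
  proof -
    have "(\<phi> has_field_derivative exp (H z + \<mu> * G z) * (deriv H z + \<mu> * deriv G z)) (at z)"
      unfolding \<phi>_def
      by (intro DERIV_fun_exp DERIV_add DERIV_cmult holomorphic_derivI[OF H(1)] holomorphic_derivI[OF G(1)] z) auto
    then show ?thesis by (simp add: dH[OF z] dG[OF z] p_def \<phi>_def algebra_simps)
  qed
  have \<phi>': "deriv \<phi> z = \<phi> z * (p z * (1 + \<mu> * ?\<omega> z))" if "z \<in> ?D" for z
    using d\<phi>[OF that] by (rule DERIV_imp_deriv)
  have dp: "(p has_field_derivative deriv (deriv h) z / h z - (p z)\<^sup>2) (at z)" if z: "z \<in> ?D" for z
  proof -
    have "(p has_field_derivative (deriv (deriv h) z * h z - deriv h z * deriv h z) / (h z * h z)) (at z)"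
      unfolding p_def
      by (intro DERIV_divide holomorphic_derivI[OF holh'] holomorphic_derivI[OF holh] z nz(1)) auto
    then show ?thesis using nz(1)[OF z] by (simp add: p_def diff_divide_distrib power2_eq_square)
  qed
  have nz\<mu>: "1 + \<mu> * ?\<omega> z \<noteq> 0" if "z \<in> ?D" for z
  proof
    assume "1 + \<mu> * ?\<omega> z = 0"
    then have "\<mu> * ?\<omega> z = - 1" by (simp add: add_eq_0_iff)
    then have "cmod (\<mu> * ?\<omega> z) = 1" by simp
    then show False using \<mu>(1) \<omega>1[OF that] by (simp add: norm_mult)
  qed
  have p0: "p z \<noteq> 0" if "z \<in> ?D" for z using nz[OF that] by (simp add: p_def)
  have \<phi>0: "\<phi> z \<noteq> 0" for z by (simp add: \<phi>_def)
  \<comment> \<open>The logarithmic derivative of phi p (1 + mu omega) is p (1 + mu omega) + p'/p +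
    mu omega'/(1 + mu omega). As p'/p = h''/h' - p, one p cancels.\<close>
  have \<phi>'': "deriv (deriv \<phi>) z / deriv \<phi> z =
      deriv (deriv h) z / deriv h z + \<mu> * deriv ?\<omega> z / (1 + \<mu> * ?\<omega> z) + \<mu> * ?\<omega> z * p z"
    if z: "z \<in> ?D" for z
  proof -
    have "((\<lambda>z. \<phi> z * (p z * (1 + \<mu> * ?\<omega> z))) has_field_derivative
        \<phi> z * (p z * (1 + \<mu> * ?\<omega> z)) * (p z * (1 + \<mu> * ?\<omega> z)) +
        ((deriv (deriv h) z / h z - (p z)\<^sup>2) * (1 + \<mu> * ?\<omega> z) + (0 + \<mu> * deriv ?\<omega> z) * p z) * \<phi> z) (at z)"
      by (intro DERIV_mult d\<phi> dp DERIV_add DERIV_const DERIV_cmult holomorphic_derivI[OF hol\<omega>] z) auto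
    then have "(deriv \<phi> has_field_derivative
        \<phi> z * (p z * (1 + \<mu> * ?\<omega> z)) * (p z * (1 + \<mu> * ?\<omega> z)) +
        ((deriv (deriv h) z / h z - (p z)\<^sup>2) * (1 + \<mu> * ?\<omega> z) + (0 + \<mu> * deriv ?\<omega> z) * p z) * \<phi> z) (at z)"
      by (rule has_field_derivative_transform_within_open[OF _ open_ball z]) (simp add: \<phi>')
    then have "deriv (deriv \<phi>) z / deriv \<phi> z =
      (\<phi> z * (p z * (1 + \<mu> * ?\<omega> z)) * (p z * (1 + \<mu> * ?\<omega> z)) +
        ((deriv (deriv h) z / h z - (p z)\<^sup>2) * (1 + \<mu> * ?\<omega> z) + (0 + \<mu> * deriv ?\<omega> z) * p z) * \<phi> z)
        / (\<phi> z * (p z * (1 + \<mu> * ?\<omega> z)))"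
      by (simp only: DERIV_imp_deriv \<phi>'[OF z])
    also have "\<dots> = deriv (deriv h) z / h z / p z + \<mu> * deriv ?\<omega> z / (1 + \<mu> * ?\<omega> z) + \<mu> * ?\<omega> z * p z"
    proof -
      have alg: "(F * (P * M) * (P * M) + ((h2 - P\<^sup>2) * M + (0 + W) * P) * F) / (F * (P * M)) = h2 / P + W / M + (M - 1) * P"
        if "F \<noteq> 0" "P \<noteq> 0" "M \<noteq> 0" for F P M h2 W :: complex
        using that by (simp add: field_simps power2_eq_square)
      show ?thesis using alg[OF \<phi>0 p0[OF z] nz\<mu>[OF z]] by simp
    qed
    also have "deriv (deriv h) z / h z / p z = deriv (deriv h) z / deriv h z"
      using nz[OF z] by (simp add: p_def)
    finally show ?thesis .
  qed
  have "inj_on \<phi> ?D"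
  proof (rule becker_univalence)
    show "\<phi> holomorphic_on ?D" unfolding \<phi>_def by (intro holomorphic_intros H G)
    fix z assume z: "z \<in> ?D"
    show d0: "deriv \<phi> z \<noteq> 0" using \<phi>0 p0[OF z] nz\<mu>[OF z] by (simp add: \<phi>'[OF z])
    define \<omega> where "\<omega> = ?\<omega> z"
    define \<omega>' where "\<omega>' = deriv ?\<omega> z"
    define X where "X = \<mu> / (1 + \<mu> * \<omega>) + cnj \<omega> / of_real (1 - (cmod \<omega>)\<^sup>2)"
    have X: "cmod X = 1 / (1 - (cmod \<omega>)\<^sup>2)"
      unfolding X_def \<omega>_def by (rule norm_unimodular_dilatation_shift[OF \<mu>(1) \<omega>1[OF z]])
    have "z * (deriv (deriv \<phi>) z / deriv \<phi> z) =
        z * pre_Schwarzian h g z + (\<mu> - 1) * \<omega> * (z * p z) + (z * \<omega>') * X"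
      unfolding \<phi>''[OF z] pre_Schwarzian_def X_def p_def \<omega>_def \<omega>'_def
      by (simp add: algebra_simps)
    also have "cmod \<dots> \<le> cmod (z * pre_Schwarzian h g z) + cmod ((\<mu> - 1) * \<omega> * (z * p z)) + cmod ((z * \<omega>') * X)"
      by (intro order_trans[OF norm_triangle_ineq] add_mono norm_triangle_ineq order_refl)
    \<comment> \<open>Here \<open>cmod \<omega> < 1\<close> turns the natural factor 2 |omega| into
      1 + |omega|.\<close>
    also have "cmod ((\<mu> - 1) * \<omega> * (z * p z)) \<le> (1 + cmod \<omega>) * cmod (z * p z)"
    proof -
      have "cmod (\<mu> - 1) \<le> 2" using norm_triangle_ineq4[of \<mu> 1] \<mu>(1) by simp
      then have "cmod ((\<mu> - 1) * \<omega>) \<le> 2 * cmod \<omega>" by (simp add: norm_mult mult_right_mono)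
      then have "cmod ((\<mu> - 1) * \<omega>) \<le> 1 + cmod \<omega>" using \<omega>1[OF z] by (simp add: \<omega>_def)
      then show ?thesis unfolding norm_mult[of "(\<mu> - 1) * \<omega>"] by (intro mult_right_mono) auto
    qed
    also have "cmod ((z * \<omega>') * X) = cmod (z * \<omega>') / (1 - (cmod \<omega>)\<^sup>2)"
      unfolding norm_mult[of "z * \<omega>'"] X by simp
    also have "cmod (z * pre_Schwarzian h g z) + (1 + cmod \<omega>) * cmod (z * p z) + cmod (z * \<omega>') / (1 - (cmod \<omega>)\<^sup>2)
        \<le> 1 / (1 - (cmod z)\<^sup>2)"
      using bound[OF z] by (simp only: \<omega>_def \<omega>'_def p_def)
    finally have "cmod (z * deriv (deriv \<phi>) z) / cmod (deriv \<phi> z) \<le> 1 / (1 - (cmod z)\<^sup>2)"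
      by (simp add: norm_divide norm_mult)
    moreover have "1 - (cmod z)\<^sup>2 > 0" using z by (simp add: power_less_one_iff)
    ultimately show "(1 - (cmod z)\<^sup>2) * cmod (z * deriv (deriv \<phi>) z) \<le> cmod (deriv \<phi> z)"
      using d0 by (simp add: divide_simps mult_ac)
  qed
  then show "z1 = z2" using eq z12 by (meson inj_onD)
qed

section \<open>Sharpness: the conformal map v + exp v onto a half-plane\<close>

text \<open>The critical points of v + exp v on the edges of the strip are i pi and -i pi. Their
  values -1 + i pi and -1 - i pi lie on the boundary line of the half-plane Re p > -1.\<close>

definition cycloid_halfplane_dom :: "complex set" where
  "cycloid_halfplane_dom = {v. \<bar>Im v\<bar> < pi \<and> -1 < Re (v + exp v)}"

text \<open>With x = Re v, the difference of the two sides is exp(2 x) - 1 - 2 x, which vanishes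
  exactly for x = 0. For p = v + exp v the pre-Schwarzian of exp v as a function of p is 1/(1 + exp
  v)^2, so this is Becker's condition in the half-plane, with equality along the imaginary
  segment.\<close>

lemma Re_add_exp_le_norm_square: "2 * (Re (v + exp v) + 1) \<le> (cmod (1 + exp v))\<^sup>2"
proof -
  have alg: "(1 + e * x)\<^sup>2 + (e * y)\<^sup>2 = 1 + 2 * e * x + e\<^sup>2 * (x\<^sup>2 + y\<^sup>2)" for e x y :: real
    by (simp add: power2_eq_square algebra_simps)
  have "(cmod (1 + exp v))\<^sup>2 = 1 + 2 * exp (Re v) * cos (Im v) + (exp (Re v))\<^sup>2"
    using alg[of "exp (Re v)" "cos (Im v)" "sin (Im v)"] by (simp add: cmod_power2 Re_exp Im_exp)
  moreover have "exp (Re v) ^ 2 \<ge> 1 + 2 * Re v"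
    using exp_ge_add_one_self[of "2 * Re v"] by (simp add: exp_double)
  ultimately show ?thesis by (simp add: Re_exp)
qed

text \<open>Controls the error terms that have only one factor 1 + exp v in the denominator. Its
  constant is absolute, so epsilon can be fixed before the radius R that depends on it.\<close>

lemma Re_add_exp_le_norm: "Re (v + exp v) + 1 \<le> 2 * cmod (1 + exp v)"
proof -
  have "Re v \<le> exp (Re v) - 1" using exp_ge_add_one_self[of "Re v"] by linarith
  also have "exp (Re v) \<le> cmod (1 + exp v) + 1"
    using norm_triangle_ineq4[of "1 + exp v" 1] by (simp add: norm_exp_eq_Re)
  finally show ?thesis using complex_Re_le_cmod[of "1 + exp v"] by simp
qed

text \<open>For x = Re v >= 0 in the strip, exp x <= |v + exp v| + x + 4, and the quadratic lower
  bound for exp x cancels the linear term. It serves both properness and the bound \<open>B\<close>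
  on exp (c v).\<close>

lemma abs_Re_le_norm_add_exp:
  assumes "\<bar>Im v\<bar> \<le> pi"
  shows "\<bar>Re v\<bar> \<le> cmod (v + exp v) + 4"
proof (cases "Re v \<ge> 0")
  case True
  have "exp (Re v) = cmod ((v + exp v) - v)" by (simp add: norm_exp_eq_Re)
  also have "\<dots> \<le> cmod (v + exp v) + cmod v" by (rule norm_triangle_ineq4)
  also have "cmod v \<le> Re v + 4"
    using cmod_le[of v] assms True pi_less_4 by simp
  finally have "exp (Re v) \<le> cmod (v + exp v) + (Re v + 4)" by simp
  moreover have "1 + Re v + (Re v)\<^sup>2 / 2 \<le> exp (Re v)" using exp_lower_Taylor_quadratic[OF True] .
  moreover have "Re v \<le> 1 + (Re v)\<^sup>2 / 2" using zero_le_power2[of "Re v - 1"]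
    by (simp add: power2_eq_square algebra_simps)
  ultimately show ?thesis using True by simp
next
  case False
  then have "exp (Re v) \<le> 1" by simp
  have "\<bar>Re v\<bar> \<le> \<bar>Re (v + exp v)\<bar> + \<bar>Re (exp v)\<bar>" by simp
  also have "\<bar>Re (exp v)\<bar> \<le> 1"
    using abs_Re_le_cmod[of "exp v"] \<open>exp (Re v) \<le> 1\<close> unfolding norm_exp_eq_Re by linarith
  finally show ?thesis using abs_Re_le_cmod[of "v + exp v"] by simp
qed

lemma open_cycloid_halfplane_dom: "open cycloid_halfplane_dom"
proof -
  have "cycloid_halfplane_dom = {v. \<bar>Im v\<bar> < pi} \<inter> {v. -1 < Re (v + exp v)}"
    by (auto simp: cycloid_halfplane_dom_def)
  then show ?thesis
    by (elim ssubst) (intro open_Int open_Collect_less continuous_intros)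
qed

lemma cycloid_halfplane_dom_nz: "v \<in> cycloid_halfplane_dom \<Longrightarrow> 1 + exp v \<noteq> 0"
  using Re_add_exp_le_norm_square[of v] by (auto simp: cycloid_halfplane_dom_def)

lemma bij_betw_add_exp:
  "bij_betw (\<lambda>v. v + exp v) cycloid_halfplane_dom {p. -1 < Re p}"
proof (rule proper_locally_injective_imp_bij_betw[where ?w0.0 = 1 and F = "\<lambda>v::complex. v + exp v"
      and A = cycloid_halfplane_dom and B = "{p. -1 < Re p}"])
  let ?A = cycloid_halfplane_dom
  show "continuous_on ?A (\<lambda>v. v + exp v)" by (intro continuous_intros)
  show "connected {p::complex. -1 < Re p}"
    by (intro convex_connected) (simp add: convex_halfspace_Re_gt)
  show "(\<lambda>v. v + exp v) ` ?A \<subseteq> {p. -1 < Re p}" by (auto simp: cycloid_halfplane_dom_def)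
  show "\<exists>r>0. ball z r \<subseteq> ?A \<and> inj_on (\<lambda>v. v + exp v) (ball z r)" if z: "z \<in> ?A" for z
  proof -
    have "((\<lambda>v. v + exp v) has_field_derivative 1 + exp z) (at z)"
      by (auto intro!: derivative_eq_intros)
    then have "deriv (\<lambda>v. v + exp v) z \<noteq> 0"
      using cycloid_halfplane_dom_nz[OF z] by (simp add: DERIV_imp_deriv)
    moreover have "(\<lambda>v. v + exp v) holomorphic_on ?A" by (intro holomorphic_intros)
    ultimately show ?thesis
      using has_complex_derivative_locally_injective[OF _ z open_cycloid_halfplane_dom] by metis
  qed
  show "\<exists>a\<in>?A. \<exists>r. strict_mono r \<and> (\<lambda>n. x (r n)) \<longlonglongrightarrow> a"
    if x: "\<And>n. x n \<in> ?A" "(\<lambda>n. x n + exp (x n)) \<longlonglongrightarrow> l" "l \<in> {p. -1 < Re p}" for x l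
  proof -
    have im: "\<bar>Im (x n)\<bar> \<le> pi" for n using x(1)[of n] by (simp add: cycloid_halfplane_dom_def)
    have "bounded (range (\<lambda>n. x n + exp (x n)))" using x(2) by (rule convergent_imp_bounded)
    then obtain Q where Q: "\<And>n. cmod (x n + exp (x n)) \<le> Q" unfolding bounded_iff by auto
    have "cmod (x n) \<le> Q + 8" for n
      using cmod_le[of "x n"] abs_Re_le_norm_add_exp[OF im[of n]] Q[of n] im[of n] pi_less_4 by simp
    then have "bounded (range x)" unfolding bounded_iff by auto
    then obtain a r where r: "strict_mono r" "(\<lambda>n. x (r n)) \<longlonglongrightarrow> a"
      using bounded_imp_convergent_subsequence[of x] by (auto simp: o_def)
    have "(\<lambda>n. x (r n) + exp (x (r n))) \<longlonglongrightarrow> a + exp a" by (intro tendsto_intros r)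
    moreover have "(\<lambda>n. x (r n) + exp (x (r n))) \<longlonglongrightarrow> l"
      using LIMSEQ_subseq_LIMSEQ[OF x(2) r(1)] by (simp add: o_def)
    ultimately have "a + exp a = l" by (rule LIMSEQ_unique)
    then have re: "-1 < Re (a + exp a)" using x(3) by simp
    have "(\<lambda>n. \<bar>Im (x (r n))\<bar>) \<longlonglongrightarrow> \<bar>Im a\<bar>" by (intro tendsto_intros r)
    then have "\<bar>Im a\<bar> \<le> pi" using im by (intro LIMSEQ_le_const2) auto
    moreover have "\<bar>Im a\<bar> \<noteq> pi"
    proof
      assume "\<bar>Im a\<bar> = pi"
      then have "cos (Im a) = -1" by (metis cos_abs_real cos_pi)
      then show False using re exp_ge_add_one_self[of "Re a"] by (simp add: Re_exp)
    qed
    ultimately have "a \<in> ?A" using re by (simp add: cycloid_halfplane_dom_def)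
    then show ?thesis using r by blast
  qed
  show "1 \<in> {p::complex. -1 < Re p}" by simp
  \<comment> \<open>In the strip sin (Im v) has the sign of Im v, so the imaginary part of v + exp v
    vanishes only for real v; on the real line x + exp x takes the value 1 only at 0.\<close>
  show "\<exists>!v. v \<in> ?A \<and> v + exp v = 1"
  proof (rule ex1I[of _ 0])
    show "0 \<in> ?A \<and> 0 + exp 0 = (1::complex)" by (simp add: cycloid_halfplane_dom_def)
    fix v assume v: "v \<in> ?A \<and> v + exp v = 1"
    then have "Im (v + exp v) = Im 1" "Re (v + exp v) = Re 1" by simp_all
    then have im: "Im v + exp (Re v) * sin (Im v) = 0" and re: "Re v + exp (Re v) * cos (Im v) = 1"
      by (simp_all add: Re_exp Im_exp)
    have pi: "\<bar>Im v\<bar> < pi" using v by (simp add: cycloid_halfplane_dom_def)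
    have "Im v = 0"
    proof (rule ccontr)
      assume "Im v \<noteq> 0"
      then consider "0 < Im v" | "0 < - Im v" by linarith
      then show False
      proof cases
        case 1
        then have "0 < exp (Re v) * sin (Im v)" using pi by (intro mult_pos_pos sin_gt_zero) auto
        then show False using im 1 by simp
      next
        case 2
        then have "0 < exp (Re v) * sin (- Im v)" using pi by (intro mult_pos_pos sin_gt_zero) auto
        then show False using im 2 by simp
      qed
    qed
    moreover have "Re v = 0"
    proof (rule ccontr)
      assume "Re v \<noteq> 0"
      then consider "0 < Re v" "exp (Re v) > 1" | "Re v < 0" "exp (Re v) < 1" by fastforce
      moreover have "Re v + exp (Re v) = 1" using re \<open>Im v = 0\<close> by simp
      ultimately show False by cases linarith+
    qed
    ultimately show "v = 0" by (simp add: complex_eq_iff)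
  qed
qed

section \<open>Sharpness: the perturbed function on the disc\<close>

text \<open>For \<open>c = 1\<close> the function \<open>p \<mapsto> exp (c v)\<close> with \<open>p = v + exp v\<close> is extremal for Becker's
  criterion in the half-plane \<open>Re p > -1\<close>: the segment \<open>v \<in> i [- \<pi>, \<pi>]\<close> gives a cycloid with both end
  points on the boundary, and the Becker extension collapses its mirror image to a single point. For
  \<open>c > 1\<close> the points \<open>v = \<plusminus> i \<pi> / c\<close> lie inside and have the same image. Restricting to a large disc
  internally tangent to the boundary gives a function on the unit disc (the composition is with an
  affine map, so no term is added to the pre-Schwarzian), and \<open>1 + \<delta> exp (c v)\<close> with small \<open>\<delta>\<close>
  makes \<open>h' / h\<close> negligible.\<close>

lemma becker_constant_sharp:
  fixes C :: real
  assumes "C > 1"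
  obtains h where "h holomorphic_on ball 0 1"
    "\<And>z. z \<in> ball 0 1 \<Longrightarrow> h z \<noteq> 0 \<and> deriv h z \<noteq> 0"
    "\<And>z. z \<in> ball 0 1 \<Longrightarrow>
       cmod (z * (deriv (deriv h) z / deriv h z)) + cmod (z * (deriv h z / h z)) \<le> C / (1 - (cmod z)\<^sup>2)"
    "\<not> inj_on h (ball 0 1)"
proof -
  let ?A = cycloid_halfplane_dom
  let ?F = "\<lambda>v::complex. v + exp v"
  define V where "V = inv_into ?A ?F"
  have V: "V p \<in> ?A" "?F (V p) = p" if "-1 < Re p" for p
    using bij_betw_add_exp that unfolding V_def bij_betw_def
    by (auto intro: inv_into_into f_inv_into_f[of _ ?F])
  have VF: "V (?F v) = v" if "v \<in> ?A" for v
    using bij_betw_add_exp that unfolding V_def bij_betw_def by (simp add: inv_into_f_f[of ?F])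
  have dV: "(V has_field_derivative inverse (1 + exp (V p))) (at p)" if p: "-1 < Re p" for p
  proof (rule has_field_derivative_inverse_strong_x[where f = ?F and S = ?A])
    show "(?F has_field_derivative 1 + exp (V p)) (at (V p))" by (auto intro!: derivative_eq_intros)
    show "continuous_on ?A ?F" by (intro continuous_intros)
  qed (use V[OF p] VF cycloid_halfplane_dom_nz open_cycloid_halfplane_dom in auto)
  \<comment> \<open>The excess C - 1 is split evenly: raising the exponent to c = 1 + epsilon costs
    at most 4 epsilon, and the h'/h term takes the other half.\<close>
  define \<epsilon> where "\<epsilon> = (C - 1) / 8"
  define c where "c = 1 + \<epsilon>"
  have \<epsilon>: "\<epsilon> > 0" and c: "c > 1" using assms by (simp_all add: \<epsilon>_def c_def)
  define v where "v = \<i> * of_real (pi / c)"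
  define p where "p = ?F v"
  have vA: "v \<in> ?A" "cnj v \<in> ?A"
  proof -
    have "pi / c < pi" "0 < pi / c" using c by (simp_all add: field_simps)
    then have "cos (pi / c) > cos pi" by (intro cos_monotone_0_pi) auto
    then show "v \<in> ?A" "cnj v \<in> ?A"
      using \<open>pi / c < pi\<close> \<open>0 < pi / c\<close> by (simp_all add: cycloid_halfplane_dom_def v_def Re_exp)
  qed
  have Fcnj: "?F (cnj v) = cnj p" by (simp add: p_def exp_cnj)
  \<comment> \<open>\<open>T\<close> maps the unit disc onto the disc of centre R - 1 and radius R,
    tangent to Re q = -1 at -1. A point q is inside iff |q + 1|^2 < 2 R (Re q + 1); this
    \<open>R\<close> makes |p + 1|^2 equal to half of the right side, for p and for cnj p.\<close>
  define R where "R = (cmod (p + 1))\<^sup>2 / (Re p + 1)"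
  have Rep: "Re p + 1 > 0" using vA(1) by (simp add: cycloid_halfplane_dom_def p_def)
  then have "p + 1 \<noteq> 0" by (metis plus_complex.sel(1) one_complex.sel(1) less_irrefl zero_complex.sel(1))
  then have R: "R > 0" using Rep by (simp add: R_def)
  define T where "T z = of_real R * (1 + z) - 1" for z :: complex
  have T_eq: "2 * (Re (T z) + 1) - R * (1 - (cmod z)\<^sup>2) = R * (cmod (1 + z))\<^sup>2" for z
    by (simp add: T_def cmod_power2) (simp add: power2_eq_square algebra_simps)
  \<comment> \<open>Transfers half-plane estimates to the disc: the weight 1 - |z|^2, scaled by R,
    is at most twice the distance of \<open>T z\<close> from the line.\<close>
  have T: "R * (1 - (cmod z)\<^sup>2) \<le> 2 * (Re (T z) + 1)" for z
    using T_eq[of z] R by (smt (verit) mult_nonneg_nonneg zero_le_power2)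
  have d1: "1 - (cmod z)\<^sup>2 > 0" if "z \<in> ball 0 1" for z :: complex
    using that by (simp add: power_less_one_iff)
  have T1: "-1 < Re (T z)" if "z \<in> ball 0 1" for z
    using less_le_trans[OF mult_pos_pos[OF R d1[OF that]] T] by simp
  define B where "B = exp (c * (2 * R + 5))"
  have B: "B > 0" by (simp add: B_def)
  have EB: "cmod (exp (of_real c * V (T z))) \<le> B" if z: "z \<in> ball 0 1" for z
  proof -
    note TV = V[OF T1[OF z]]
    have "\<bar>Re (V (T z))\<bar> \<le> cmod (T z) + 4"
      using abs_Re_le_norm_add_exp[of "V (T z)"] TV by (simp add: cycloid_halfplane_dom_def)
    also have "cmod (T z) \<le> R * cmod (1 + z) + 1"
      unfolding T_def by (rule order_trans[OF norm_triangle_ineq4]) (use R in \<open>simp add: norm_mult\<close>)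
    also have "cmod (1 + z) \<le> 2" using norm_triangle_ineq[of 1 z] z by simp
    finally have "Re (V (T z)) \<le> 2 * R + 5" using R by simp
    then show ?thesis using c by (simp add: norm_exp_eq_Re B_def)
  qed
  \<comment> \<open>The first entry keeps |h| >= 1/2; the second bounds the h'/h contribution, at
    most 2 delta c * 4 * B, by (C - 1) / 2.\<close>
  define \<delta> where "\<delta> = min (1 / (2 * B)) ((C - 1) / (16 * c * B))"
  have \<delta>: "\<delta> > 0" "\<delta> * B \<le> 1 / 2" "8 * c * \<delta> * B \<le> (C - 1) / 2"
  proof -
    show "\<delta> > 0" using B c assms by (simp add: \<delta>_def)
    have "\<delta> * B \<le> 1 / (2 * B) * B" "\<delta> * B \<le> (C - 1) / (16 * c * B) * B"
      using B by (intro mult_right_mono; simp add: \<delta>_def)+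
    then have "\<delta> * B \<le> 1 / 2" "\<delta> * B \<le> (C - 1) / (16 * c)" using B by simp_all
    then show "\<delta> * B \<le> 1 / 2" "8 * c * \<delta> * B \<le> (C - 1) / 2" using c by (simp_all add: field_simps)
  qed
  define E where "E z = exp (of_real c * V (T z))" for z
  define W where "W z = 1 + exp (V (T z))" for z
  define h where "h z = 1 + of_real \<delta> * E z" for z
  have W0: "W z \<noteq> 0" if "z \<in> ball 0 1" for z
    using cycloid_halfplane_dom_nz[OF V(1)[OF T1[OF that]]] by (simp add: W_def)
  have dVT: "((\<lambda>z. V (T z)) has_field_derivative inverse (W z) * of_real R) (at z)" if "z \<in> ball 0 1" for z
  proof -
    have "(T has_field_derivative of_real R) (at z)"
      unfolding T_def by (auto intro!: derivative_eq_intros)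
    from DERIV_chain2[OF dV[OF T1[OF that]] this] show ?thesis by (simp add: W_def)
  qed
  have dE: "(E has_field_derivative E z * (of_real c * (inverse (W z) * of_real R))) (at z)"
    if "z \<in> ball 0 1" for z
    unfolding E_def by (intro DERIV_fun_exp DERIV_cmult dVT that)
  have dW: "(W has_field_derivative 0 + exp (V (T z)) * (inverse (W z) * of_real R)) (at z)"
    if "z \<in> ball 0 1" for z
    unfolding W_def[abs_def] using dVT[OF that] by (intro DERIV_add DERIV_const DERIV_fun_exp) (simp add: W_def)
  have dh: "(h has_field_derivative 0 + of_real \<delta> * (E z * (of_real c * (inverse (W z) * of_real R)))) (at z)"
    if "z \<in> ball 0 1" for z
    unfolding h_def by (intro DERIV_add DERIV_const DERIV_cmult dE that)
  define k :: complex where "k = of_real (\<delta> * c * R)"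
  have k0: "k \<noteq> 0" using \<delta> c R by (simp add: k_def)
  have h': "deriv h z = k * E z / W z" if "z \<in> ball 0 1" for z
    using DERIV_imp_deriv[OF dh[OF that]] by (simp add: k_def field_simps)
  \<comment> \<open>The constant 1 and the factor delta do not affect h''/h'. The numerator is c W -
    (W - 1) = 1 + epsilon W: the extremal term plus a perturbation of order epsilon/W.\<close>
  have h'': "deriv (deriv h) z / deriv h z = of_real R * (1 + of_real \<epsilon> * W z) / (W z)\<^sup>2" if z: "z \<in> ball 0 1" for z
  proof -
    have "((\<lambda>z. k * E z / W z) has_field_derivative
        (k * (E z * (of_real c * (inverse (W z) * of_real R))) * W z
         - k * E z * (0 + exp (V (T z)) * (inverse (W z) * of_real R))) / (W z * W z)) (at z)"
      by (intro DERIV_divide DERIV_cmult dE dW W0 z)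
    then have "(deriv h has_field_derivative
        (k * (E z * (of_real c * (inverse (W z) * of_real R))) * W z
         - k * E z * (0 + exp (V (T z)) * (inverse (W z) * of_real R))) / (W z * W z)) (at z)"
      by (rule has_field_derivative_transform_within_open[OF _ open_ball z]) (simp add: h')
    moreover have "exp (V (T z)) = W z - 1" by (simp add: W_def)
    ultimately have "deriv (deriv h) z = (k * (E z * (of_real c * (inverse (W z) * of_real R))) * W z
         - k * E z * (0 + (W z - 1) * (inverse (W z) * of_real R))) / (W z * W z)"
      by (simp only: DERIV_imp_deriv)
    moreover have "E z \<noteq> 0" by (simp add: E_def)
    moreover have "((k * (F * ((1 + e) * (inverse w * r))) * w - k * F * (0 + (w - 1) * (inverse w * r))) / (w * w))
        / (k * F / w) = r * (1 + e * w) / w\<^sup>2" if "F \<noteq> 0" "w \<noteq> 0" for F w r e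
      using that k0 by (simp add: divide_simps power2_eq_square) (simp add: algebra_simps)
    ultimately show ?thesis
      using W0[OF z] unfolding h'[OF z] c_def of_real_add of_real_1 by metis
  qed
  have hge: "cmod (h z) \<ge> 1 / 2" if "z \<in> ball 0 1" for z
  proof -
    have "cmod (of_real \<delta> * E z) \<le> \<delta> * B"
      using EB[OF that] \<delta>(1) by (simp add: norm_mult E_def)
    then have "cmod (of_real \<delta> * E z) \<le> 1 / 2" using \<delta>(2) by linarith
    then show ?thesis using norm_diff_ineq[of 1 "of_real \<delta> * E z"] by (simp add: h_def)
  qed
  show thesis
  proof (rule that)
    show "h holomorphic_on ball 0 1" using dh holomorphic_on_open by blast
    show "h z \<noteq> 0 \<and> deriv h z \<noteq> 0" if "z \<in> ball 0 1" for z
      using hge[OF that] W0[OF that] k0 by (auto simp: h'[OF that] E_def)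
    show "cmod (z * (deriv (deriv h) z / deriv h z)) + cmod (z * (deriv h z / h z)) \<le> C / (1 - (cmod z)\<^sup>2)"
      if z: "z \<in> ball 0 1" for z
    proof -
      define m where "m = cmod (W z)"
      define d where "d = 1 - (cmod z)\<^sup>2"
      have m: "m > 0" using W0[OF z] by (simp add: m_def)
      have d: "d > 0" using d1[OF z] by (simp add: d_def)
      have sq: "R * d \<le> m\<^sup>2"
        using T[of z] Re_add_exp_le_norm_square[of "V (T z)"] V(2)[OF T1[OF z]]
        by (simp add: m_def W_def d_def)
      have lin: "R * d \<le> 4 * m"
        using T[of z] Re_add_exp_le_norm[of "V (T z)"] V(2)[OF T1[OF z]]
        by (simp add: m_def W_def d_def)
      have "cmod (deriv (deriv h) z / deriv h z) \<le> R * (1 + \<epsilon> * m) / m\<^sup>2"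
      proof -
        have "cmod (1 + of_real \<epsilon> * W z) \<le> 1 + \<epsilon> * m"
          using norm_triangle_ineq[of 1 "of_real \<epsilon> * W z"] \<epsilon> by (simp add: norm_mult m_def)
        then show ?thesis unfolding h''[OF z] using R m
          by (simp add: norm_mult norm_divide norm_power divide_right_mono flip: m_def)
      qed
      then have "d * cmod (deriv (deriv h) z / deriv h z) \<le> d * (R * (1 + \<epsilon> * m) / m\<^sup>2)"
        using d by (intro mult_left_mono) auto
      \<comment> \<open>\<open>sq\<close> bounds the extremal term by 1, and \<open>lin\<close>
        bounds the perturbation by 4 epsilon.\<close>
      also have "\<dots> = R * d / m\<^sup>2 + \<epsilon> * (R * d / m)" using m by (simp add: field_simps power2_eq_square)
      also have "\<dots> \<le> 1 + \<epsilon> * 4"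
        using sq lin m \<epsilon> by (intro add_mono mult_left_mono) (simp_all add: field_simps)
      also have "\<dots> = 1 + (C - 1) / 2" by (simp add: \<epsilon>_def field_simps)
      finally have 1: "d * cmod (deriv (deriv h) z / deriv h z) \<le> 1 + (C - 1) / 2" .
      have "d * cmod (deriv h z / h z) \<le> d * (cmod (deriv h z) / (1 / 2))"
        using hge[OF z] d unfolding norm_divide by (intro mult_left_mono divide_left_mono) auto
      also have "\<dots> = 2 * \<delta> * c * (R * d / m) * cmod (E z)"
        using \<delta>(1) c R by (simp add: h'[OF z] norm_mult norm_divide k_def m_def)
      also have "\<dots> \<le> 2 * \<delta> * c * 4 * B"
        using lin m d R \<delta>(1) c EB[OF z] by (intro mult_mono) (simp_all add: E_def field_simps)
      also have "\<dots> \<le> (C - 1) / 2" using \<delta>(3) by (simp add: mult_ac)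
      finally have 2: "d * cmod (deriv h z / h z) \<le> (C - 1) / 2" .
      have "d * (cmod (z * (deriv (deriv h) z / deriv h z)) + cmod (z * (deriv h z / h z)))
        = cmod z * (d * cmod (deriv (deriv h) z / deriv h z) + d * cmod (deriv h z / h z))"
        unfolding norm_mult[of z] by (simp only: distrib_left mult.left_commute)
      also have "\<dots> \<le> 1 * C"
        using 1 2 z d assms by (intro mult_mono) (auto simp: field_simps)
      finally show ?thesis using d unfolding d_def[symmetric] by (simp add: field_simps)
    qed
    define z where "z q = (q + 1) / of_real R - 1" for q :: complex
    have Tz: "T (z q) = q" for q using R by (simp add: T_def z_def)
    have zin: "z q \<in> ball 0 1" if "Re q = Re p" "cmod (q + 1) = cmod (p + 1)" for q
    proof -
      have "2 * (Re q + 1) - R * (1 - (cmod (z q))\<^sup>2) = R * (cmod (1 + z q))\<^sup>2"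
        using T_eq[of "z q"] by (simp only: Tz)
      also have "1 + z q = (q + 1) / of_real R" by (simp add: z_def)
      also have "R * (cmod ((q + 1) / of_real R))\<^sup>2 = (cmod (p + 1))\<^sup>2 / R"
        using R that by (simp add: norm_divide power2_eq_square)
      also have "\<dots> = Re p + 1" using Rep \<open>p + 1 \<noteq> 0\<close> by (simp add: R_def)
      finally have "R * (1 - (cmod (z q))\<^sup>2) > 0" using Rep that by simp
      then show ?thesis using R by (simp add: zero_less_mult_iff power_less_one_iff)
    qed
    have "E (z p) = exp (of_real c * v)" "E (z (cnj p)) = exp (of_real c * cnj v)"
      unfolding E_def Tz Fcnj[symmetric] VF[OF vA(2)] by (simp_all add: p_def VF[OF vA(1)])
    moreover have "of_real c * v = \<i> * of_real pi" "of_real c * cnj v = - (\<i> * of_real pi)"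
      using c by (simp_all add: v_def)
    ultimately have "h (z p) = h (z (cnj p))" by (simp add: h_def exp_minus)
    moreover have "z p \<noteq> z (cnj p)"
    proof
      assume "z p = z (cnj p)"
      then have "p = cnj p" using Tz by metis
      then have "v = cnj v" using VF[OF vA(1)] VF[OF vA(2)] Fcnj by (simp add: p_def)
      then show False using c by (simp add: v_def complex_eq_iff)
    qed
    moreover have "z p \<in> ball 0 1" "z (cnj p) \<in> ball 0 1"
      using zin[of p] zin[of "cnj p"] complex_mod_cnj[of "p + 1"] by simp_all
    ultimately show "\<not> inj_on h (ball 0 1)" by (meson inj_onD)
  qed
qed

theorem theorem3:
  shows "(\<forall>f h g. sense_preserving_logharmonic_on (ball 0 1) f h g \<longrightarrow>
            (\<forall>z\<in>ball 0 1.
               cmod (z * pre_Schwarzian h g z)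
               + (1 + cmod (dilatation h g z)) * cmod (z * (deriv h z / h z))
               + cmod (z * deriv (dilatation h g) z) / (1 - (cmod (dilatation h g z))\<^sup>2)
               \<le> 1 / (1 - (cmod z)\<^sup>2)) \<longrightarrow>
            inj_on f (ball 0 1)) \<and>
         (\<forall>C::real. C > 1 \<longrightarrow>
            (\<exists>f h g. sense_preserving_logharmonic_on (ball 0 1) f h g \<and>
               (\<forall>z\<in>ball 0 1.
                  cmod (z * pre_Schwarzian h g z)
                  + (1 + cmod (dilatation h g z)) * cmod (z * (deriv h z / h z))
                  + cmod (z * deriv (dilatation h g) z) / (1 - (cmod (dilatation h g z))\<^sup>2)
                  \<le> C / (1 - (cmod z)\<^sup>2)) \<and>
               \<not> inj_on f (ball 0 1)))"
proof (intro conjI allI impI)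
  fix f h g
  assume "sense_preserving_logharmonic_on (ball 0 1) f h g"
    and "\<forall>z\<in>ball 0 1.
               cmod (z * pre_Schwarzian h g z)
               + (1 + cmod (dilatation h g z)) * cmod (z * (deriv h z / h z))
               + cmod (z * deriv (dilatation h g) z) / (1 - (cmod (dilatation h g z))\<^sup>2)
               \<le> 1 / (1 - (cmod z)\<^sup>2)"
  then show "inj_on f (ball 0 1)" by (intro logharmonic_becker_univalence) blast+
next
  fix C :: real assume "C > 1"
  then obtain h where h: "h holomorphic_on ball 0 1"
    "\<And>z. z \<in> ball 0 1 \<Longrightarrow> h z \<noteq> 0 \<and> deriv h z \<noteq> 0"
    "\<And>z. z \<in> ball 0 1 \<Longrightarrow>
       cmod (z * (deriv (deriv h) z / deriv h z)) + cmod (z * (deriv h z / h z)) \<le> C / (1 - (cmod z)\<^sup>2)"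
    "\<not> inj_on h (ball 0 1)"
    using becker_constant_sharp by metis
  have \<omega>: "dilatation h (\<lambda>_. 1) = (\<lambda>_. 0)" by (simp add: fun_eq_iff dilatation_def)
  have "sense_preserving_logharmonic_on (ball 0 1) h h (\<lambda>_. 1)"
    using h by (simp add: sense_preserving_logharmonic_on_def \<omega>)
  moreover have "cmod (z * pre_Schwarzian h (\<lambda>_. 1) z)
      + (1 + cmod (dilatation h (\<lambda>_. 1) z)) * cmod (z * (deriv h z / h z))
      + cmod (z * deriv (dilatation h (\<lambda>_. 1)) z) / (1 - (cmod (dilatation h (\<lambda>_. 1) z))\<^sup>2)
      \<le> C / (1 - (cmod z)\<^sup>2)" if "z \<in> ball 0 1" for z
    using h(3)[OF that] by (simp add: pre_Schwarzian_def \<omega>)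
  ultimately show "\<exists>f h g. sense_preserving_logharmonic_on (ball 0 1) f h g \<and>
               (\<forall>z\<in>ball 0 1.
                  cmod (z * pre_Schwarzian h g z)
                  + (1 + cmod (dilatation h g z)) * cmod (z * (deriv h z / h z))
                  + cmod (z * deriv (dilatation h g) z) / (1 - (cmod (dilatation h g z))\<^sup>2)
                  \<le> C / (1 - (cmod z)\<^sup>2)) \<and>
               \<not> inj_on f (ball 0 1)"
    using h(4) by blast
qed

end
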